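(* For every $l\in(0,1)$, the function $$e(p,q):=\log\frac{|p-q|}{|pq|^l},\qquad p,q\in\mathbb C\setminus\{0\},\ p\ne q,$$ is an Evans kernel on $\mathbb C\setminus\{0\}$.
   Context: Let $\Sigma$ be an open Riemann surface and $q\in\Sigma$. An Evans-Selberg potential on $\Sigma$ with pole $q$ is a real-valued function $E_q(p)$ such that: (i) $E_q(p)$ is harmonic in $p$ on $\Sigma\setminus\{q\}$; (ii) $E_q(p)-\log|\varphi(p)-\varphi(q)|$ is bounded near $q$, where $\varphi$ is a local coordinate; (iii) $E_q(p)\to+\infty$ as $p\to a_\infty$, the Alexandroff ideal boundary point of $\Sigma$ (i.e. the point at infinity of the one-point compactification of $\Sigma$). An Evans kernel on $\Sigma$ is a function $E(p,q)$ such that, for each $q\in\Sigma$, $E_q(p):=E(p,q)$ is an Evans-Selberg potential with pole $q$; $E$ is symmetric in $(p,q)$; and for any pair $(q,q')$ of points of $\Sigma$ the function $p\mapsto E(p,q)-E(p,q')$ is bounded near the boundary (i.e. near the ideal boundary point $a_\infty$). *)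

theory Defs
  imports "HOL-Complex_Analysis.Complex_Analysis"
begin

text \<open>
  A chart is a pair consisting of its domain and a coordinate map. The map is a total function of
  the logic; only its values on the domain matter.
\<close>

type_synonym 'a chart = "'a set \<times> ('a \<Rightarrow> complex)"

definition is_chart :: "'a topology \<Rightarrow> 'a chart \<Rightarrow> bool" where
  "is_chart X c \<longleftrightarrow> (case c of (U, \<phi>) \<Rightarrow>
     openin X U \<and> open (\<phi> ` U) \<and>
     homeomorphic_map (subtopology X U) (top_of_set (\<phi> ` U)) \<phi>)"

definition compatible_charts :: "'a chart \<Rightarrow> 'a chart \<Rightarrow> bool" where
  "compatible_charts c d \<longleftrightarrow> (case c of (U, \<phi>) \<Rightarrow> case d of (V, \<psi>) \<Rightarrow>
     (\<phi> \<circ> inv_into V \<psi>) holomorphic_on \<psi> ` (U \<inter> V) \<and>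
     (\<psi> \<circ> inv_into U \<phi>) holomorphic_on \<phi> ` (U \<inter> V))"

text \<open>
  A Riemann surface is a connected Hausdorff space with a holomorphic atlas; a countable base
  need not be required, by Rado's theorem.
\<close>

definition riemann_surface :: "'a topology \<Rightarrow> 'a chart set \<Rightarrow> bool" where
  "riemann_surface X \<A> \<longleftrightarrow>
     topspace X \<noteq> {} \<and> Hausdorff_space X \<and> connected_space X \<and>
     (\<forall>c\<in>\<A>. is_chart X c) \<and>
     (\<Union>c\<in>\<A>. fst c) = topspace X \<and>
     (\<forall>c\<in>\<A>. \<forall>d\<in>\<A>. compatible_charts c d)"

definition open_riemann_surface :: "'a topology \<Rightarrow> 'a chart set \<Rightarrow> bool" where
  "open_riemann_surface X \<A> \<longleftrightarrow> riemann_surface X \<A> \<and> \<not> compact_space X"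

text \<open>
  The local coordinates are the charts of the maximal atlas determined by \<open>\<A>\<close>.
\<close>

definition local_coordinate :: "'a topology \<Rightarrow> 'a chart set \<Rightarrow> 'a set \<Rightarrow> ('a \<Rightarrow> complex) \<Rightarrow> bool" where
  "local_coordinate X \<A> U \<phi> \<longleftrightarrow>
     is_chart X (U, \<phi>) \<and> (\<forall>c\<in>\<A>. compatible_charts (U, \<phi>) c)"

text \<open>
  Harmonic functions on an open subset of the plane: twice continuously differentiable with
  vanishing Laplacian. The functions \<open>ux\<close>, \<open>uy\<close>, \<open>uxx\<close>, \<open>uxy\<close>, \<open>uyx\<close>, \<open>uyy\<close> are the first and second
  partial derivatives of \<open>u\<close>.
\<close>

definition harmonic_on :: "(complex \<Rightarrow> real) \<Rightarrow> complex set \<Rightarrow> bool"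
    (infixl "harmonic'_on" 50) where
  "u harmonic_on S \<longleftrightarrow> open S \<and>
     (\<exists>ux uy uxx uxy uyx uyy.
        continuous_on S uxx \<and> continuous_on S uxy \<and>
        continuous_on S uyx \<and> continuous_on S uyy \<and>
        (\<forall>z\<in>S.
           (u has_derivative (\<lambda>h. ux z * Re h + uy z * Im h)) (at z) \<and>
           (ux has_derivative (\<lambda>h. uxx z * Re h + uxy z * Im h)) (at z) \<and>
           (uy has_derivative (\<lambda>h. uyx z * Re h + uyy z * Im h)) (at z) \<and>
           uxx z + uyy z = 0))"

definition surface_harmonic_on ::
    "'a topology \<Rightarrow> 'a chart set \<Rightarrow> ('a \<Rightarrow> real) \<Rightarrow> 'a set \<Rightarrow> bool" where
  "surface_harmonic_on X \<A> u S \<longleftrightarrow> openin X S \<and>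
     (\<forall>U \<phi>. local_coordinate X \<A> U \<phi> \<longrightarrow> (u \<circ> inv_into U \<phi>) harmonic_on \<phi> ` (U \<inter> S))"

text \<open>
  The filter on the space itself of punctured neighbourhoods of the point at infinity \<open>None\<close> of
  the one-point compactification, in which the space is embedded by \<open>Some\<close>.
\<close>

definition ideal_boundary :: "'a topology \<Rightarrow> 'a filter" where
  "ideal_boundary X = filtercomap Some (atin (Alexandroff_compactification X) None)"

definition bounded_near :: "('a \<Rightarrow> real) \<Rightarrow> 'a filter \<Rightarrow> bool" where
  "bounded_near f F \<longleftrightarrow> (\<exists>B. eventually (\<lambda>p. \<bar>f p\<bar> \<le> B) F)"

text \<open>
  The value of a potential at its own pole is never used: \<open>atin X q\<close> is the filter of punctured
  neighbourhoods of \<open>q\<close>.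
\<close>

definition evans_selberg_potential ::
    "'a topology \<Rightarrow> 'a chart set \<Rightarrow> 'a \<Rightarrow> ('a \<Rightarrow> real) \<Rightarrow> bool" where
  "evans_selberg_potential X \<A> q u \<longleftrightarrow>
     open_riemann_surface X \<A> \<and> q \<in> topspace X \<and>
     surface_harmonic_on X \<A> u (topspace X - {q}) \<and>
     (\<forall>U \<phi>. local_coordinate X \<A> U \<phi> \<and> q \<in> U \<longrightarrow>
        bounded_near (\<lambda>p. u p - ln (cmod (\<phi> p - \<phi> q))) (atin X q)) \<and>
     filterlim u at_top (ideal_boundary X)"

definition evans_kernel ::
    "'a topology \<Rightarrow> 'a chart set \<Rightarrow> ('a \<Rightarrow> 'a \<Rightarrow> real) \<Rightarrow> bool" where
  "evans_kernel X \<A> E \<longleftrightarrow>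
     open_riemann_surface X \<A> \<and>
     (\<forall>q\<in>topspace X. evans_selberg_potential X \<A> q (\<lambda>p. E p q)) \<and>
     (\<forall>p\<in>topspace X. \<forall>q\<in>topspace X. p \<noteq> q \<longrightarrow> E p q = E q p) \<and>
     (\<forall>q\<in>topspace X. \<forall>q'\<in>topspace X.
        bounded_near (\<lambda>p. E p q - E p q') (ideal_boundary X))"

text \<open>
  The standard Riemann surface structure of a plane domain: one chart, the identity.
\<close>

definition plane_atlas :: "complex set \<Rightarrow> complex chart set" where
  "plane_atlas S = {(S, \<lambda>z. z)}"

end

theory Submission
  imports Defs
begin

text \<open>
  For \<open>p \<noteq> q\<close> in the punctured plane the kernel is
  \<open>e(p,q) = ln \<bar>p - q\<bar> - l ln \<bar>p\<bar> - l ln \<bar>q\<bar>\<close>, which is visibly symmetric.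

  Harmonicity in \<open>p\<close>: a local coordinate \<open>\<phi>\<close> has a holomorphic inverse \<open>g\<close>, and the real
  differential of \<open>ln \<bar>f\<bar>\<close> for a zero-free holomorphic \<open>f\<close> is \<open>h \<mapsto> Re ((f'/f) h)\<close>. So \<open>e(g(z),q)\<close>
  has the differential \<open>h \<mapsto> Re (H(z) h)\<close> with \<open>H = g'/(g - q) - l g'/g\<close> holomorphic, and every
  real function with such a differential is harmonic (lemma \<open>harmonic_on_if_Re_differential\<close>).

  Logarithmic pole: \<open>\<phi>\<close> is holomorphic and injective, so \<open>\<phi>'(q) \<noteq> 0\<close> and
  \<open>ln \<bar>p - q\<bar> - ln \<bar>\<phi>(p) - \<phi>(q)\<bar>\<close> converges to \<open>- ln \<bar>\<phi>'(q)\<bar>\<close> as \<open>p \<rightarrow> q\<close>.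

  Ideal boundary: a set is a punctured neighbourhood of the ideal boundary point as soon as it
  contains the complement of a closed annulus around \<open>0\<close>, so a limit or
  boundedness statement there follows from the corresponding statements at \<open>0\<close> and at \<open>\<infinity>\<close>
  (lemma \<open>ideal_boundary_punctured_plane_le\<close>). Near \<open>0\<close> the
  potential behaves like \<open>- l ln \<bar>p\<bar>\<close>, near \<open>\<infinity>\<close> like \<open>(1 - l) ln \<bar>p\<bar>\<close>; both tend to \<open>+\<infinity>\<close>
  exactly because \<open>0 < l < 1\<close>. In \<open>e(p,q) - e(p,q')\<close> the terms \<open>- l ln \<bar>p\<bar>\<close> cancel, and finite
  limits remain at both ends.
\<close>

section \<open>Plane domains as Riemann surfaces\<close>

lemma riemann_surface_plane_domain:
  assumes "open S" "connected S" "S \<noteq> {}"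
  shows "riemann_surface (top_of_set S) (plane_atlas S)"
proof -
  have "is_chart (top_of_set S) (S, \<lambda>z. z)"
    using assms homeomorphic_map_id[of "top_of_set S" "top_of_set S"]
    by (simp add: is_chart_def id_def subtopology_subtopology)
  moreover have "compatible_charts (S, \<lambda>z. z) (S, \<lambda>z. z)"
  proof -
    \<comment> \<open>\<open>inv_into S (\<lambda>z. z)\<close> is the identity on \<open>S\<close> only; outside \<open>S\<close> its values are arbitrary.\<close>
    have "inv_into S (\<lambda>z. z) holomorphic_on S"
      by (rule holomorphic_transform[OF holomorphic_on_ident])
         (use inv_into_f_f[of "\<lambda>z. z" S] in auto)
    then show ?thesis
      by (simp add: compatible_charts_def o_def)
  qed
  moreover have "Hausdorff_space (top_of_set S)"
    by (intro Hausdorff_space_subtopology Hausdorff_space_euclidean)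
  moreover have "connected_space (top_of_set S)"
    using assms by (simp add: connected_space_subtopology)
  ultimately show ?thesis
    using assms by (auto simp: riemann_surface_def plane_atlas_def)
qed

text \<open>
  On a plane domain, compatibility with the identity chart says precisely that a local coordinate
  is holomorphic together with its inverse.
\<close>

lemma local_coordinate_plane_domain:
  assumes "open S" and coord: "local_coordinate (top_of_set S) (plane_atlas S) U \<phi>"
  shows "open U" and "U \<subseteq> S" and "open (\<phi> ` U)" and "inj_on \<phi> U"
    and "\<phi> holomorphic_on U" and "inv_into U \<phi> holomorphic_on \<phi> ` U"
proof -
  have chart: "openin (top_of_set S) U" "open (\<phi> ` U)"
    "homeomorphic_map (subtopology (top_of_set S) U) (top_of_set (\<phi> ` U)) \<phi>"
    and compat: "compatible_charts (U, \<phi>) (S, \<lambda>z. z)"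
    using coord by (auto simp: local_coordinate_def is_chart_def plane_atlas_def)
  show "open (\<phi> ` U)" by (rule chart(2))
  show "open U" and US: "U \<subseteq> S"
    using chart(1) \<open>open S\<close> by (auto simp: openin_open_eq)
  then have [simp]: "U \<inter> S = U" "S \<inter> U = U" by auto
  show "inj_on \<phi> U"
    using homeomorphic_imp_injective_map[OF chart(3)] by simp
  show "inv_into U \<phi> holomorphic_on \<phi> ` U"
    using compat by (simp add: compatible_charts_def o_def)
  have "(\<phi> \<circ> inv_into S (\<lambda>z. z)) holomorphic_on U"
    using compat by (simp add: compatible_charts_def)
  then show "\<phi> holomorphic_on U"
    by (rule holomorphic_transform)
       (use US inv_into_f_f[of "\<lambda>z. z" S] in auto)
qed

section \<open>Harmonicity of logarithms of moduli\<close>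

text \<open>
  A real function whose differential is the real part of a holomorphic one-form \<open>H(z) dz\<close> is
  harmonic: by the Cauchy-Riemann equations its second partial derivatives are the real and
  imaginary parts of \<open>H'\<close>, up to sign.
\<close>

lemma harmonic_on_if_Re_differential:
  assumes "open S" and H: "H holomorphic_on S"
    and u: "\<And>z. z \<in> S \<Longrightarrow> (u has_derivative (\<lambda>h. Re (H z * h))) (at z)"
  shows "u harmonic_on S"
proof -
  have dH: "(H has_derivative (\<lambda>h. deriv H z * h)) (at z)" if "z \<in> S" for z
    using holomorphic_derivI[OF H \<open>open S\<close> that] by (simp add: has_field_derivative_def)
  have cont: "continuous_on S (deriv H)"
    using H \<open>open S\<close> by (intro holomorphic_on_imp_continuous_on holomorphic_deriv)
  show ?thesis
    unfolding harmonic_on_def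
  proof (intro conjI exI ballI)
    fix z assume z: "z \<in> S"
    show "(u has_derivative (\<lambda>h. Re (H z) * Re h + (- Im (H z)) * Im h)) (at z)"
      using u[OF z] by simp
    show "((\<lambda>z. Re (H z)) has_derivative
            (\<lambda>h. Re (deriv H z) * Re h + (- Im (deriv H z)) * Im h)) (at z)"
      using has_derivative_Re[OF dH[OF z]] by simp
    show "((\<lambda>z. - Im (H z)) has_derivative
            (\<lambda>h. (- Im (deriv H z)) * Re h + (- Re (deriv H z)) * Im h)) (at z)"
      using has_derivative_minus[OF has_derivative_Im[OF dH[OF z]]]
      by (simp add: algebra_simps)
    show "Re (deriv H z) + (- Re (deriv H z)) = 0"
      by simp
  qed (intro assms continuous_intros cont)+
qed

lemma has_derivative_ln_cmod:
  assumes f: "(f has_field_derivative f') (at z)" and "f z \<noteq> 0"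
  shows "((\<lambda>z. ln (cmod (f z))) has_derivative (\<lambda>h. Re (f' / f z * h))) (at z)"
proof -
  have "(f has_derivative (\<lambda>h. f' * h)) (at z)"
    using f by (simp add: has_field_derivative_def)
  from has_derivative_compose[OF this has_derivative_norm[OF \<open>f z \<noteq> 0\<close>]]
  have "((\<lambda>z. cmod (f z)) has_derivative (\<lambda>h. inner (f' * h) (sgn (f z)))) (at z)" .
  from has_derivative_ln[OF _ this] \<open>f z \<noteq> 0\<close>
  have "((\<lambda>z. ln (cmod (f z))) has_derivative
          (\<lambda>h. inner (f' * h) (sgn (f z)) * inverse (cmod (f z)))) (at z)"
    by simp
  also have "(\<lambda>h. inner (f' * h) (sgn (f z)) * inverse (cmod (f z))) =
             (\<lambda>h. Re (f' / f z * h))"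
  proof
    fix h
    \<comment> \<open>Multiplying by \<open>cnj (f z)\<close> turns the real part into a real inner product.\<close>
    have "f' / f z * h = (f' * h) * cnj (f z) / of_real ((cmod (f z))\<^sup>2)"
      using \<open>f z \<noteq> 0\<close> complex_norm_square[of "f z"] by (simp add: field_simps)
    then have "Re (f' / f z * h) = inner (f' * h) (f z) / (cmod (f z))\<^sup>2"
      by (simp only: Re_divide_of_real) (simp add: inner_complex_def)
    then show "inner (f' * h) (sgn (f z)) * inverse (cmod (f z)) = Re (f' / f z * h)"
      by (simp add: sgn_div_norm power2_eq_square field_simps)
  qed
  finally show ?thesis .
qed

section \<open>The ideal boundary of the punctured plane\<close>

lemma bounded_near_if_tendsto:
  assumes "(f \<longlongrightarrow> c) F"
  shows "bounded_near f F"
proof -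
  have "eventually (\<lambda>p. dist (f p) c < 1) F"
    using assms by (rule tendstoD) simp
  then have "eventually (\<lambda>p. \<bar>f p\<bar> \<le> \<bar>c\<bar> + 1) F"
    by eventually_elim (auto simp: dist_real_def)
  then show ?thesis
    unfolding bounded_near_def by blast
qed

lemma bounded_near_mono:
  assumes "bounded_near f G" "F \<le> G"
  shows "bounded_near f F"
  using assms unfolding bounded_near_def by (meson filter_leD)

lemma bounded_near_sup:
  assumes "bounded_near f F" "bounded_near f G"
  shows "bounded_near f (sup F G)"
proof -
  obtain B C where "eventually (\<lambda>p. \<bar>f p\<bar> \<le> B) F" "eventually (\<lambda>p. \<bar>f p\<bar> \<le> C) G"
    using assms by (auto simp: bounded_near_def)
  then have "eventually (\<lambda>p. \<bar>f p\<bar> \<le> max B C) (sup F G)"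
    by (auto simp: eventually_sup elim: eventually_mono)
  then show ?thesis
    unfolding bounded_near_def by blast
qed

lemma eventually_ideal_boundaryI:
  assumes "compactin X K" "closedin X K" and "\<And>p. p \<in> topspace X - K \<Longrightarrow> P p"
  shows "eventually P (ideal_boundary X)"
proof -
  let ?V = "insert None (Some ` (topspace X - K))"
  have "openin (Alexandroff_compactification X) ?V"
    using assms(1,2) by (auto simp: openin_Alexandroff_compactification)
  then have "eventually (\<lambda>y. y \<in> Some ` (topspace X - K))
               (atin (Alexandroff_compactification X) None)"
    unfolding eventually_atin by (intro disjI2 exI[of _ ?V]) auto
  then show ?thesis
    unfolding ideal_boundary_def eventually_filtercomap
    using assms(3) by blast
qed

text \<open>
  The two filters are in fact equal; only this inequality is needed.
\<close>

lemma ideal_boundary_punctured_plane_le: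
  "ideal_boundary (top_of_set (UNIV - {0::complex})) \<le> sup (at 0) at_infinity"
proof (rule filter_leI)
  fix P :: "complex \<Rightarrow> bool"
  assume "eventually P (sup (at 0) at_infinity)"
  then obtain d b where d: "d > 0" "\<And>p. p \<noteq> 0 \<Longrightarrow> cmod p < d \<Longrightarrow> P p"
    and b: "\<And>p. b \<le> cmod p \<Longrightarrow> P p"
    by (auto simp: eventually_sup eventually_at eventually_at_infinity dist_norm)
  let ?K = "cball 0 b - ball (0::complex) d"
  have "compact ?K"
    by (intro compact_diff) auto
  moreover have "?K \<subseteq> UNIV - {0}"
    using d(1) by auto
  ultimately have "compactin (top_of_set (UNIV - {0})) ?K"
    by (simp add: compactin_subtopology)
  moreover from this have "closedin (top_of_set (UNIV - {0})) ?K"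
    by (intro compactin_imp_closedin Hausdorff_space_subtopology Hausdorff_space_euclidean)
  ultimately show "eventually P (ideal_boundary (top_of_set (UNIV - {0})))"
  proof (rule eventually_ideal_boundaryI)
    fix p assume "p \<in> topspace (top_of_set (UNIV - {0})) - ?K"
    then show "P p"
      using d(2)[of p] b[of p] by (auto simp: not_le)
  qed
qed

section \<open>The Evans kernel of the punctured plane\<close>

lemma open_riemann_surface_punctured_plane:
  "open_riemann_surface (top_of_set (UNIV - {0})) (plane_atlas (UNIV - {0}))"
proof -
  have "connected (UNIV - {0::complex})"
    using connected_punctured_universe[of "0::complex"] by (simp add: Compl_eq_Diff_UNIV)
  moreover have "UNIV - {0::complex} \<noteq> {}"
    by (metis DiffI UNIV_I empty_iff one_neq_zero singletonD)
  moreover have "\<not> compact_space (top_of_set (UNIV - {0::complex}))"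
  proof
    assume "compact_space (top_of_set (UNIV - {0::complex}))"
    then have "compactin euclidean (UNIV - {0::complex})"
      by (simp add: compactin_subspace)
    then have "compact (UNIV - {0::complex})"
      by simp
    from compact_imp_bounded[OF this, THEN bounded_insert[THEN iffD2], of 0] show False
      by simp
  qed
  ultimately show ?thesis
    unfolding open_riemann_surface_def
    by (auto intro!: riemann_surface_plane_domain open_delete)
qed

lemma ln_kernel_eq:
  fixes p q :: complex
  assumes "p \<noteq> 0" "q \<noteq> 0" "p \<noteq> q"
  shows "ln (cmod (p - q) / cmod (p * q) powr l) =
         ln (cmod (p - q)) - l * ln (cmod p) - l * ln (cmod q)"
  using assms by (simp add: ln_div ln_powr norm_mult ln_mult algebra_simps)

lemma surface_harmonic_on_ln_kernel:
  assumes "q \<noteq> 0"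
  shows "surface_harmonic_on (top_of_set (UNIV - {0})) (plane_atlas (UNIV - {0}))
           (\<lambda>p. ln (cmod (p - q) / cmod (p * q) powr l)) (UNIV - {0} - {q})"
  unfolding surface_harmonic_on_def
proof (intro conjI allI impI)
  show "openin (top_of_set (UNIV - {0})) (UNIV - {0} - {q})"
    by (auto simp: openin_open_eq open_delete)
next
  fix U \<phi>
  assume coord: "local_coordinate (top_of_set (UNIV - {0})) (plane_atlas (UNIV - {0})) U \<phi>"
  note c = local_coordinate_plane_domain[OF open_delete[OF open_UNIV] coord]
  define g where "g = inv_into U \<phi>"
  let ?u = "\<lambda>p. ln (cmod (p - q) / cmod (p * q) powr l)"
  let ?T = "\<phi> ` (U \<inter> (UNIV - {0} - {q}))"
  have g: "g (\<phi> p) = p" if "p \<in> U" for p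
    using c(4) that by (simp add: g_def)
  have gT: "g z \<noteq> 0 \<and> g z \<noteq> q" if "z \<in> ?T" for z
    using that g by auto
  \<comment> \<open>The coordinate image of \<open>U\<close> without the pole is open, since \<open>\<phi>\<close> is injective on \<open>U\<close>.\<close>
  have "?T = \<phi> ` U - {\<phi> q} \<or> ?T = \<phi> ` U"
  proof (cases "q \<in> U")
    case True
    then show ?thesis
      using c(2,4) by (auto simp: inj_on_def)
  next
    case False
    then show ?thesis
      using c(2) by auto
  qed
  then have T: "open ?T"
    using c(3) by (auto simp: open_delete)
  have hg: "g holomorphic_on ?T"
    using c(6) unfolding g_def by (rule holomorphic_on_subset) auto
  let ?H = "\<lambda>z. deriv g z / (g z - q) - of_real l * (deriv g z / g z)"
  show "(?u \<circ> inv_into U \<phi>) harmonic_on ?T"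
    unfolding g_def[symmetric]
  proof (rule harmonic_on_if_Re_differential[OF T])
    show "?H holomorphic_on ?T"
      using gT by (intro holomorphic_intros holomorphic_deriv hg T) auto
    fix z assume z: "z \<in> ?T"
    have dg: "(g has_field_derivative deriv g z) (at z)"
      by (rule holomorphic_derivI[OF hg T z])
    have dgq: "((\<lambda>z. g z - q) has_field_derivative deriv g z) (at z)"
      using DERIV_diff[OF dg DERIV_const[of q]] by simp
    have "((\<lambda>z. ln (cmod (g z - q)) - l * ln (cmod (g z)) - l * ln (cmod q)) has_derivative
            (\<lambda>h. Re (deriv g z / (g z - q) * h) - l * Re (deriv g z / g z * h) - 0)) (at z)"
      using gT[OF z]
      by (intro has_derivative_diff has_derivative_mult_right has_derivative_const
          has_derivative_ln_cmod[OF dgq] has_derivative_ln_cmod[OF dg]) auto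
    also have "(\<lambda>h. Re (deriv g z / (g z - q) * h) - l * Re (deriv g z / g z * h) - 0) =
        (\<lambda>h. Re (?H z * h))"
    proof
      fix h
      have "?H z * h = deriv g z / (g z - q) * h - of_real l * (deriv g z / g z * h)"
        by (simp only: left_diff_distrib mult.assoc)
      then show "Re (deriv g z / (g z - q) * h) - l * Re (deriv g z / g z * h) - 0 = Re (?H z * h)"
        by (simp only: minus_complex.sel scaleR_complex.sel diff_0_right flip: scaleR_conv_of_real)
    qed
    finally have "((\<lambda>z. ln (cmod (g z - q)) - l * ln (cmod (g z)) - l * ln (cmod q))
            has_derivative (\<lambda>h. Re (?H z * h))) (at z)" .
    then show "(?u \<circ> g has_derivative (\<lambda>h. Re (?H z * h))) (at z)"
    proof (rule has_derivative_transform_within_open[OF _ T z])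
      fix w assume "w \<in> ?T"
      then show "ln (cmod (g w - q)) - l * ln (cmod (g w)) - l * ln (cmod q) = (?u \<circ> g) w"
        using ln_kernel_eq[of "g w" q l] gT[of w] assms by simp
    qed
  qed
qed

lemma bounded_near_pole_ln_kernel:
  assumes "q \<noteq> 0" "q \<in> U"
    and coord: "local_coordinate (top_of_set (UNIV - {0})) (plane_atlas (UNIV - {0})) U \<phi>"
  shows "bounded_near (\<lambda>p. ln (cmod (p - q) / cmod (p * q) powr l) - ln (cmod (\<phi> p - \<phi> q)))
           (atin (top_of_set (UNIV - {0})) q)"
proof -
  note c = local_coordinate_plane_domain[OF open_delete[OF open_UNIV] coord]
  have "atin (top_of_set (UNIV - {0})) q = at q"
  proof (rule filter_eq_iff[THEN iffD2, rule_format])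
    fix P :: "complex \<Rightarrow> bool"
    have "openin (top_of_set (UNIV - {0})) V \<longleftrightarrow> open V \<and> 0 \<notin> V" for V :: "complex set"
      by (auto simp: openin_open_eq open_delete)
    then have "eventually P (atin (top_of_set (UNIV - {0})) q) \<longleftrightarrow>
        (\<exists>V. open V \<and> 0 \<notin> V \<and> q \<in> V \<and> (\<forall>p\<in>V - {q}. P p))"
      using \<open>q \<noteq> 0\<close> by (simp add: eventually_atin)
    also have "\<dots> \<longleftrightarrow> eventually P (at q)"
    proof
      assume "eventually P (at q)"
      then obtain V where "open V" "q \<in> V" "\<forall>p\<in>V. p \<noteq> q \<longrightarrow> P p"
        by (auto simp: eventually_at_topological)
      then show "\<exists>V. open V \<and> 0 \<notin> V \<and> q \<in> V \<and> (\<forall>p\<in>V - {q}. P p)"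
        using \<open>q \<noteq> 0\<close> by (intro exI[of _ "V - {0}"]) (auto simp: open_delete)
    qed (auto simp: eventually_at_topological)
    finally show "eventually P (atin (top_of_set (UNIV - {0})) q) = eventually P (at q)" .
  qed
  moreover have "bounded_near
      (\<lambda>p. ln (cmod (p - q) / cmod (p * q) powr l) - ln (cmod (\<phi> p - \<phi> q))) (at q)"
  proof (rule bounded_near_if_tendsto)
    have "deriv \<phi> q \<noteq> 0"
      by (rule holomorphic_injective_imp_regular[OF c(5,1,4) \<open>q \<in> U\<close>])
    moreover have "((\<lambda>p. (\<phi> p - \<phi> q) / (p - q)) \<longlongrightarrow> deriv \<phi> q) (at q)"
      using holomorphic_derivI[OF c(5,1) \<open>q \<in> U\<close>] by (simp add: has_field_derivative_iff)
    ultimately have "((\<lambda>p. - ln (cmod ((\<phi> p - \<phi> q) / (p - q))) - l * ln (cmod p) - l * ln (cmod q))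
        \<longlongrightarrow> - ln (cmod (deriv \<phi> q)) - l * ln (cmod q) - l * ln (cmod q)) (at q)"
      using \<open>q \<noteq> 0\<close> by (intro tendsto_intros) auto
    moreover have "eventually (\<lambda>p. - ln (cmod ((\<phi> p - \<phi> q) / (p - q))) - l * ln (cmod p)
         - l * ln (cmod q) =
        ln (cmod (p - q) / cmod (p * q) powr l) - ln (cmod (\<phi> p - \<phi> q))) (at q)"
      using eventually_at_in_open[OF c(1) \<open>q \<in> U\<close>]
    proof eventually_elim
      case (elim p)
      then have "p \<noteq> q" "p \<noteq> 0" "\<phi> p \<noteq> \<phi> q"
        using c(2,4) \<open>q \<in> U\<close> by (auto simp: inj_on_def)
      then show ?case
        using ln_kernel_eq[of p q l] \<open>q \<noteq> 0\<close> by (simp add: norm_divide ln_div)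
    qed
    ultimately show "((\<lambda>p. ln (cmod (p - q) / cmod (p * q) powr l) - ln (cmod (\<phi> p - \<phi> q)))
        \<longlongrightarrow> - ln (cmod (deriv \<phi> q)) - l * ln (cmod q) - l * ln (cmod q)) (at q)"
      by (rule Lim_transform_eventually)
  qed
  ultimately show ?thesis by simp
qed

lemma eventually_at_0_avoids:
  assumes "q \<noteq> (0::complex)"
  shows "eventually (\<lambda>p. p \<noteq> 0 \<and> p \<noteq> q) (at 0)"
  using eventually_at_in_open[of "- {q}" 0] assms
  by (auto simp: open_Compl elim: eventually_mono)

lemma eventually_at_infinity_avoids:
  "eventually (\<lambda>p. p \<noteq> 0 \<and> p \<noteq> (q::complex)) at_infinity"
proof (rule eventually_at_infinityI)
  fix p assume "cmod q + 1 \<le> cmod p"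
  then have "0 < cmod p" "cmod q < cmod p"
    using norm_ge_zero[of q] by linarith+
  then show "p \<noteq> 0 \<and> p \<noteq> q"
    by auto
qed

lemma tendsto_ln_cmod_diff_at_infinity:
  "((\<lambda>p. ln (cmod (p - q)) - ln (cmod p)) \<longlongrightarrow> 0) at_infinity"
proof -
  have "((\<lambda>p. q / p) \<longlongrightarrow> 0) at_infinity"
    by (rule tendsto_divide_0[OF tendsto_const]) (simp add: filterlim_ident)
  then have "((\<lambda>p. ln (cmod (1 - q / p))) \<longlongrightarrow> ln (cmod (1 - 0))) at_infinity"
    by (intro tendsto_intros) auto
  moreover have "eventually (\<lambda>p. ln (cmod (1 - q / p)) = ln (cmod (p - q)) - ln (cmod p)) at_infinity"
    using eventually_at_infinity_avoids[of q]
  proof eventually_elim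
    case (elim p)
    then have "1 - q / p = (p - q) / p"
      by (simp add: field_simps)
    then show ?case
      using elim by (simp add: norm_divide ln_div)
  qed
  ultimately show ?thesis
    by (simp add: filterlim_cong)
qed

lemma filterlim_ln_kernel_ideal_boundary:
  assumes "q \<noteq> 0" "0 < l" "l < 1"
  shows "filterlim (\<lambda>p. ln (cmod (p - q) / cmod (p * q) powr l)) at_top
           (ideal_boundary (top_of_set (UNIV - {0})))"
proof (rule filterlim_mono[OF _ order_refl ideal_boundary_punctured_plane_le], rule filterlim_sup)
  have "filterlim (\<lambda>p. cmod p) (at_right 0) (at 0)"
    by (auto simp: filterlim_at eventually_at_filter intro!: tendsto_eq_intros)
  then have "filterlim (\<lambda>p. - ln (cmod p)) at_top (at 0)"
    by (intro filterlim_compose[OF filterlim_uminus_at_top_at_bot] filterlim_compose[OF ln_at_0])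
  then have "filterlim (\<lambda>p. l * - ln (cmod p)) at_top (at 0)"
    using \<open>0 < l\<close> by (rule filterlim_tendsto_pos_mult_at_top[OF tendsto_const, rotated])
  moreover have "((\<lambda>p. ln (cmod (p - q)) - l * ln (cmod q)) \<longlongrightarrow>
      ln (cmod (0 - q)) - l * ln (cmod q)) (at 0)"
    using \<open>q \<noteq> 0\<close> by (intro tendsto_intros) auto
  ultimately have "filterlim (\<lambda>p. (ln (cmod (p - q)) - l * ln (cmod q)) + l * - ln (cmod p))
      at_top (at 0)"
    by (rule filterlim_tendsto_add_at_top[rotated])
  moreover have "eventually (\<lambda>p. (ln (cmod (p - q)) - l * ln (cmod q)) + l * - ln (cmod p) =
      ln (cmod (p - q) / cmod (p * q) powr l)) (at 0)"
    using eventually_at_0_avoids[OF \<open>q \<noteq> 0\<close>]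
    by eventually_elim (use \<open>q \<noteq> 0\<close> in \<open>simp add: ln_kernel_eq\<close>)
  ultimately show "filterlim (\<lambda>p. ln (cmod (p - q) / cmod (p * q) powr l)) at_top (at 0)"
    by (rule filterlim_mono_eventually[OF _ order_refl order_refl])
next
  have "filterlim (\<lambda>p. ln (cmod p)) at_top (at_infinity :: complex filter)"
    by (rule filterlim_compose[OF ln_at_top filterlim_norm_at_top])
  moreover have "0 < 1 - l"
    using \<open>l < 1\<close> by simp
  ultimately have "filterlim (\<lambda>p. (1 - l) * ln (cmod p)) at_top (at_infinity :: complex filter)"
    by (intro filterlim_tendsto_pos_mult_at_top[OF tendsto_const])
  moreover have "((\<lambda>p. (ln (cmod (p - q)) - ln (cmod p)) - l * ln (cmod q)) \<longlongrightarrow>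
      0 - l * ln (cmod q)) at_infinity"
    by (intro tendsto_intros tendsto_ln_cmod_diff_at_infinity)
  ultimately have "filterlim (\<lambda>p. ((ln (cmod (p - q)) - ln (cmod p)) - l * ln (cmod q))
      + (1 - l) * ln (cmod p)) at_top at_infinity"
    by (rule filterlim_tendsto_add_at_top[rotated])
  moreover have "eventually (\<lambda>p. ((ln (cmod (p - q)) - ln (cmod p)) - l * ln (cmod q))
      + (1 - l) * ln (cmod p) = ln (cmod (p - q) / cmod (p * q) powr l)) at_infinity"
    using eventually_at_infinity_avoids[of q]
    by eventually_elim (use \<open>q \<noteq> 0\<close> in \<open>simp add: ln_kernel_eq algebra_simps\<close>)
  ultimately show "filterlim (\<lambda>p. ln (cmod (p - q) / cmod (p * q) powr l)) at_top at_infinity"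
    by (rule filterlim_mono_eventually[OF _ order_refl order_refl])
qed

lemma bounded_near_ln_kernel_diff:
  assumes "q \<noteq> 0" "r \<noteq> 0"
  shows "bounded_near (\<lambda>p. ln (cmod (p - q) / cmod (p * q) powr l)
                          - ln (cmod (p - r) / cmod (p * r) powr l))
           (ideal_boundary (top_of_set (UNIV - {0})))"
    (is "bounded_near ?d _")
proof (rule bounded_near_mono[OF bounded_near_sup ideal_boundary_punctured_plane_le])
  let ?c = "- l * ln (cmod q) + l * ln (cmod r)"
  have "((\<lambda>p. ln (cmod (p - q)) - ln (cmod (p - r)) + ?c) \<longlongrightarrow>
      ln (cmod (0 - q)) - ln (cmod (0 - r)) + ?c) (at 0)"
    using assms by (intro tendsto_intros) auto
  moreover have "eventually (\<lambda>p. ln (cmod (p - q)) - ln (cmod (p - r)) + ?c = ?d p) (at 0)"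
    using eventually_at_0_avoids[OF assms(1)] eventually_at_0_avoids[OF assms(2)]
    by eventually_elim (use assms in \<open>simp add: ln_kernel_eq\<close>)
  ultimately show "bounded_near ?d (at 0)"
    by (intro bounded_near_if_tendsto) (rule Lim_transform_eventually)
  \<comment> \<open>Both logarithms diverge at infinity; each is compared with \<open>ln (cmod p)\<close>.\<close>
  have "((\<lambda>p. (ln (cmod (p - q)) - ln (cmod p)) - (ln (cmod (p - r)) - ln (cmod p)) + ?c) \<longlongrightarrow>
      0 - 0 + ?c) at_infinity"
    by (intro tendsto_intros tendsto_ln_cmod_diff_at_infinity)
  moreover have "eventually (\<lambda>p. (ln (cmod (p - q)) - ln (cmod p))
      - (ln (cmod (p - r)) - ln (cmod p)) + ?c = ?d p) at_infinity"
    using eventually_at_infinity_avoids[of q] eventually_at_infinity_avoids[of r]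
    by eventually_elim (use assms in \<open>simp add: ln_kernel_eq\<close>)
  ultimately show "bounded_near ?d at_infinity"
    by (intro bounded_near_if_tendsto) (rule Lim_transform_eventually)
qed

theorem theorem1p3:
  fixes l :: real
  assumes "0 < l" and "l < 1"
  shows "evans_kernel (top_of_set (UNIV - {0})) (plane_atlas (UNIV - {0}))
           (\<lambda>p q. ln (cmod (p - q) / cmod (p * q) powr l))"
proof -
  have symmetric: "ln (cmod (p - q) / cmod (p * q) powr l) = ln (cmod (q - p) / cmod (q * p) powr l)"
    for p q :: complex
    by (simp only: norm_minus_commute[of p q] mult.commute[of p q])
  show ?thesis
    unfolding evans_kernel_def evans_selberg_potential_def
    using assms open_riemann_surface_punctured_plane
    by (intro conjI ballI allI impI symmetric; (elim conjE)?)
       (simp_all add: surface_harmonic_on_ln_kernel bounded_near_pole_ln_kernel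
        filterlim_ln_kernel_ideal_boundary bounded_near_ln_kernel_diff)
qed

end
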